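(* Let $M$ be a monoid. Then $M$ preserves finite generation in direct products if and only if the diagonal $M$-act $M\times M$ is finitely generated.
   Context: For a monoid $M$ with identity $1$, an $M$-act is a non-empty set $A$ with a map $A\times M\to A$, $(a,m)\mapsto am$, such that $a(mn)=(am)n$ and $a1=a$ for all $a\in A$, $m,n\in M$. A subset $U\subseteq A$ generates $A$ if every $a\in A$ equals $um$ for some $u\in U$, $m\in M$; $A$ is finitely generated if it has a finite generating set. The direct product of $M$-acts $A$ and $B$ is the Cartesian product $A\times B$ with action $(a,b)m=(am,bm)$. The diagonal $M$-act is the set $M\times M$ with action $(a,b)c=(ac,bc)$. A monoid $M$ preserves finite generation in direct products if for any two $M$-acts $A$ and $B$, the direct product $A\times B$ is finitely generated if and only if both $A$ and $B$ are finitely generated. *)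

theory Defs
  imports "HOL-Algebra.Group" "HOL-Library.Equipollence"
begin

locale right_act = monoid M for M (structure) +
  fixes A :: "'a set" and act :: "'a \<Rightarrow> 'm \<Rightarrow> 'a"
  assumes nonempty: "A \<noteq> {}"
    and act_closed: "\<lbrakk>a \<in> A; m \<in> carrier M\<rbrakk> \<Longrightarrow> act a m \<in> A"
    and act_mult: "\<lbrakk>a \<in> A; m \<in> carrier M; n \<in> carrier M\<rbrakk> \<Longrightarrow> act a (m \<otimes> n) = act (act a m) n"
    and act_one: "a \<in> A \<Longrightarrow> act a \<one> = a"

definition generates_act ::
    "('m, 'k) monoid_scheme \<Rightarrow> 'a set \<Rightarrow> ('a \<Rightarrow> 'm \<Rightarrow> 'a) \<Rightarrow> 'a set \<Rightarrow> bool" where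
  "generates_act M A act U \<longleftrightarrow>
     U \<subseteq> A \<and> (\<forall>a\<in>A. \<exists>u\<in>U. \<exists>m\<in>carrier M. a = act u m)"

definition finitely_generated_act ::
    "('m, 'k) monoid_scheme \<Rightarrow> 'a set \<Rightarrow> ('a \<Rightarrow> 'm \<Rightarrow> 'a) \<Rightarrow> bool" where
  "finitely_generated_act M A act \<longleftrightarrow> (\<exists>U. finite U \<and> generates_act M A act U)"

definition prod_action ::
    "('a \<Rightarrow> 'm \<Rightarrow> 'a) \<Rightarrow> ('b \<Rightarrow> 'm \<Rightarrow> 'b) \<Rightarrow> 'a \<times> 'b \<Rightarrow> 'm \<Rightarrow> 'a \<times> 'b" where
  "prod_action f g = (\<lambda>(a, b) m. (f a m, g b m))"

definition diagonal_action ::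
    "('m, 'k) monoid_scheme \<Rightarrow> 'm \<times> 'm \<Rightarrow> 'm \<Rightarrow> 'm \<times> 'm" where
  "diagonal_action M = (\<lambda>(a, b) c. (a \<otimes>\<^bsub>M\<^esub> c, b \<otimes>\<^bsub>M\<^esub> c))"

lemma right_act_prod:
  assumes "right_act M A f" and "right_act M B g"
  shows "right_act M (A \<times> B) (prod_action f g)"
proof -
  interpret A: right_act M A f by fact
  interpret B: right_act M B g by fact
  show ?thesis
    by unfold_locales
      (auto simp: prod_action_def A.nonempty B.nonempty A.act_closed B.act_closed
        A.act_mult B.act_mult A.act_one B.act_one)
qed

lemma right_act_diagonal:
  assumes "monoid M"
  shows "right_act M (carrier M \<times> carrier M) (diagonal_action M)"
proof -
  interpret monoid M by fact
  show ?thesis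
    by unfold_locales (auto simp: diagonal_action_def m_assoc)
qed

text \<open>A formula cannot quantify over types, so ``any two M-acts'' means: any act whose
  underlying set lies in type \<open>'a\<close> and any act whose underlying set lies in type \<open>'b\<close>.
  The types are explicit parameters, left free in statements.  If they are too small to hold a
  copy of \<open>carrier M\<close> the property may hold for lack of acts (for \<open>unit\<close> it always does), so
  drawing conclusions about \<open>M\<close> from it needs \<open>carrier M \<lesssim> UNIV\<close> at these types.\<close>

definition preserves_fg_products ::
    "'a itself \<Rightarrow> 'b itself \<Rightarrow> ('m, 'k) monoid_scheme \<Rightarrow> bool" where
  "preserves_fg_products _ _ M \<longleftrightarrow>
     (\<forall>(A :: 'a set) f (B :: 'b set) g. right_act M A f \<longrightarrow> right_act M B g \<longrightarrow>
        (finitely_generated_act M (A \<times> B) (prod_action f g) \<longleftrightarrow>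
         finitely_generated_act M A f \<and> finitely_generated_act M B g))"

end

theory Submission
  imports Defs
begin

text \<open>Finite generation passes along equivariant surjections, so a finitely generated product
  always has finitely generated factors, by projection. For the converse, a finite generating set of
  the diagonal act lets two independent multipliers be rewritten with a common one: if (m, n) = (d,
  e)c, then (um, vn) = (ud, ve)c, and only finitely many pairs (ud, ve) arise
  (\<open>finitely_generated_act_prod\<close>). Conversely, M acting on itself is generated by its
  identity, and the product of this act with itself is the diagonal act, so preservation makes the
  latter finitely generated.\<close>

lemma finitely_generated_act_image:
  assumes fg: "finitely_generated_act M A f" and onto: "h ` A = B"
    and equivariant: "\<And>a m. a \<in> A \<Longrightarrow> m \<in> carrier M \<Longrightarrow> h (f a m) = g (h a) m"
  shows "finitely_generated_act M B g"
proof -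
  obtain U where U: "finite U" "U \<subseteq> A" "\<And>a. a \<in> A \<Longrightarrow> \<exists>u\<in>U. \<exists>m\<in>carrier M. a = f u m"
    using fg unfolding finitely_generated_act_def generates_act_def by blast
  have "\<exists>v\<in>h ` U. \<exists>m\<in>carrier M. b = g v m" if b: "b \<in> B" for b
  proof -
    obtain a where a: "a \<in> A" "b = h a" using b onto by blast
    then obtain u m where "u \<in> U" "m \<in> carrier M" "a = f u m" using U(3) by blast
    then show ?thesis using a U(2) equivariant by blast
  qed
  moreover have "finite (h ` U)" "h ` U \<subseteq> B" using U onto by auto
  ultimately show ?thesis unfolding finitely_generated_act_def generates_act_def by blast
qed

text \<open>Each projection is equivariant, and it is onto because the other factor is
  non-empty.\<close>

lemma finitely_generated_act_prod_factors:
  assumes "finitely_generated_act M (A \<times> B) (prod_action f g)" and "A \<noteq> {}" and "B \<noteq> {}"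
  shows "finitely_generated_act M A f" and "finitely_generated_act M B g"
proof -
  show "finitely_generated_act M A f"
    by (rule finitely_generated_act_image[OF assms(1), where h = fst])
      (use assms in \<open>auto simp: prod_action_def\<close>)
  show "finitely_generated_act M B g"
    by (rule finitely_generated_act_image[OF assms(1), where h = snd])
      (use assms in \<open>auto simp: prod_action_def\<close>)
qed

lemma finitely_generated_act_prod:
  assumes A: "right_act M A f" and B: "right_act M B g"
    and diag: "finitely_generated_act M (carrier M \<times> carrier M) (diagonal_action M)"
    and fgA: "finitely_generated_act M A f" and fgB: "finitely_generated_act M B g"
  shows "finitely_generated_act M (A \<times> B) (prod_action f g)"
proof -
  interpret A: right_act M A f by fact
  interpret B: right_act M B g by fact
  obtain U where U: "finite U" "U \<subseteq> A" "\<And>a. a \<in> A \<Longrightarrow> \<exists>u\<in>U. \<exists>m\<in>carrier M. a = f u m"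
    using fgA unfolding finitely_generated_act_def generates_act_def by blast
  obtain V where V: "finite V" "V \<subseteq> B" "\<And>b. b \<in> B \<Longrightarrow> \<exists>v\<in>V. \<exists>m\<in>carrier M. b = g v m"
    using fgB unfolding finitely_generated_act_def generates_act_def by blast
  obtain D where D: "finite D" "D \<subseteq> carrier M \<times> carrier M"
    "\<And>p. p \<in> carrier M \<times> carrier M \<Longrightarrow> \<exists>d\<in>D. \<exists>c\<in>carrier M. p = diagonal_action M d c"
    using diag unfolding finitely_generated_act_def generates_act_def by blast
  \<comment> \<open>Pairs of generators, shifted by the two coordinates of a generator of the
    diagonal act.\<close>
  define W where "W = (\<lambda>(u, v, d, e). (f u d, g v e)) ` (U \<times> V \<times> D)"
  have "finite W" using U(1) V(1) D(1) unfolding W_def by blast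
  moreover have "W \<subseteq> A \<times> B"
    using U(2) V(2) D(2) by (auto simp: W_def subset_iff intro: A.act_closed B.act_closed)
  moreover have "\<exists>w\<in>W. \<exists>c\<in>carrier M. p = prod_action f g w c" if pAB: "p \<in> A \<times> B" for p
  proof -
    obtain a b where p: "p = (a, b)" "a \<in> A" "b \<in> B" using pAB by blast
    obtain u m where um: "u \<in> U" "m \<in> carrier M" "a = f u m" using U(3) p by blast
    obtain v n where vn: "v \<in> V" "n \<in> carrier M" "b = g v n" using V(3) p by blast
    obtain d e c where dec: "(d, e) \<in> D" "c \<in> carrier M" "(m, n) = diagonal_action M (d, e) c"
      using D(3)[of "(m, n)"] um(2) vn(2) by (metis mem_Sigma_iff surj_pair)
    have "(f u d, g v e) \<in> W" unfolding W_def using um(1) vn(1) dec(1) by force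
    \<comment> \<open>Since m = dc and n = ec with the same c, associativity of the actions moves c
      outside in both coordinates at once.\<close>
    moreover have "p = prod_action f g (f u d, g v e) c"
      using p um vn dec U(2) V(2) D(2)
      by (auto simp: prod_action_def diagonal_action_def A.act_mult B.act_mult subset_iff)
    ultimately show ?thesis using dec(2) by blast
  qed
  ultimately show ?thesis unfolding finitely_generated_act_def generates_act_def
    by (intro exI[of _ W] conjI ballI)
qed

text \<open>A copy of the regular act on the image of \<open>i\<close>, needed because the acts in the theorem
  live in types unrelated to that of \<open>carrier M\<close>.\<close>

definition transported_action ::
    "('m, 'k) monoid_scheme \<Rightarrow> ('m \<Rightarrow> 'a) \<Rightarrow> 'a \<Rightarrow> 'm \<Rightarrow> 'a" where
  "transported_action M i a m = i (inv_into (carrier M) i a \<otimes>\<^bsub>M\<^esub> m)"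

context monoid
begin

lemma transported_action_apply:
  assumes "inj_on i (carrier G)" and "x \<in> carrier G"
  shows "transported_action G i (i x) m = i (x \<otimes> m)"
  using assms by (simp add: transported_action_def)

lemma right_act_transported:
  assumes "inj_on i (carrier G)"
  shows "right_act G (i ` carrier G) (transported_action G i)"
  by unfold_locales (auto simp: transported_action_apply[OF assms] m_assoc)

text \<open>The copy is cyclic: the image of the identity reaches every \<open>i x\<close> by acting
  with x.\<close>

lemma finitely_generated_act_transported:
  assumes "inj_on i (carrier G)"
  shows "finitely_generated_act G (i ` carrier G) (transported_action G i)"
  unfolding finitely_generated_act_def generates_act_def
  by (rule exI[of _ "{i \<one>}"]) (auto simp: transported_action_apply[OF assms])

text \<open>Undoing \<open>i\<close> and \<open>j\<close> coordinatewise is an equivariant map from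
  the product of the two copies onto the diagonal act.\<close>

lemma finitely_generated_diagonal_if_transported:
  assumes i: "inj_on i (carrier G)" and j: "inj_on j (carrier G)"
    and fg: "finitely_generated_act G (i ` carrier G \<times> j ` carrier G)
      (prod_action (transported_action G i) (transported_action G j))"
  shows "finitely_generated_act G (carrier G \<times> carrier G) (diagonal_action G)"
proof (rule finitely_generated_act_image[OF fg,
      where h = "map_prod (inv_into (carrier G) i) (inv_into (carrier G) j)"])
  show "map_prod (inv_into (carrier G) i) (inv_into (carrier G) j) `
      (i ` carrier G \<times> j ` carrier G) = carrier G \<times> carrier G"
    using i j by (simp add: map_prod_surj_on)
qed (auto simp: prod_action_def diagonal_action_def transported_action_apply i j)

end

text \<open>The embeddings guarantee that copies of M exist in both types, which is what lets
  preservation be tested on the regular act. The second conjunct records the other implication at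
  arbitrary types.\<close>

theorem corollary4p5:
  fixes M :: "('m, 'k) monoid_scheme"
  assumes "monoid M"
  shows "(carrier M \<lesssim> (UNIV :: 'a set) \<and> carrier M \<lesssim> (UNIV :: 'b set) \<longrightarrow>
           (preserves_fg_products TYPE('a) TYPE('b) M \<longleftrightarrow>
            finitely_generated_act M (carrier M \<times> carrier M) (diagonal_action M)))
       \<and> (finitely_generated_act M (carrier M \<times> carrier M) (diagonal_action M) \<longrightarrow>
            preserves_fg_products TYPE('a) TYPE('b) M)"
proof -
  interpret monoid M by fact
  let ?D = "finitely_generated_act M (carrier M \<times> carrier M) (diagonal_action M)"
  let ?P = "preserves_fg_products TYPE('a) TYPE('b) M"
  have "?P" if diag: "?D"
    unfolding preserves_fg_products_def
  proof (intro allI impI)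
    fix A :: "'a set" and f and B :: "'b set" and g
    assume A: "right_act M A f" and B: "right_act M B g"
    show "finitely_generated_act M (A \<times> B) (prod_action f g) \<longleftrightarrow>
        finitely_generated_act M A f \<and> finitely_generated_act M B g"
      using finitely_generated_act_prod[OF A B diag]
        finitely_generated_act_prod_factors[of M A B f g]
        right_act.nonempty[OF A] right_act.nonempty[OF B] by blast
  qed
  moreover have "?D" if P: "?P"
    and emb: "carrier M \<lesssim> (UNIV :: 'a set)" "carrier M \<lesssim> (UNIV :: 'b set)"
  proof -
    obtain i :: "'m \<Rightarrow> 'a" and j :: "'m \<Rightarrow> 'b"
      where ij: "inj_on i (carrier M)" "inj_on j (carrier M)"
      using emb unfolding lepoll_def by blast
    \<comment> \<open>Preservation is applied to two cyclic acts, the copies of M in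
      \<open>'a\<close> and \<open>'b\<close>.\<close>
    have "finitely_generated_act M (i ` carrier M \<times> j ` carrier M)
        (prod_action (transported_action M i) (transported_action M j))"
      using P right_act_transported[OF ij(1)] right_act_transported[OF ij(2)]
        finitely_generated_act_transported[OF ij(1)] finitely_generated_act_transported[OF ij(2)]
      unfolding preserves_fg_products_def by simp
    then show ?thesis by (rule finitely_generated_diagonal_if_transported[OF ij])
  qed
  ultimately show ?thesis by blast
qed

end
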